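(* Let $\mathfrak X=(\mathbb R^d,d_{\rm e},\mu)$, $d\in\mathbb N$, with $d_{\rm e}$ the Euclidean metric and $\mu$ a Borel measure such that $\mu(B)\in(0,\infty)$ for every open ball $B$. Then the centered maximal operator $\mathcal M^{\rm c}_{\mathfrak X}$ possesses the dichotomy property if and only if there exists $y_0\in\mathbb R^d$ with $\limsup_{r\to\infty}\frac{\mu(B_{r+1}(y_0))}{\mu(B_r(y_0))}<\infty$.
   Context: $B_r(x)$ is the open Euclidean ball of center $x$ and radius $r$. $L^1_{\rm loc}(\mu)$: functions integrable on every open ball. $\mathcal M^{\rm c}f(x)=\sup_{r>0}\mu(B_r(x))^{-1}\int_{B_r(x)}|f|d\mu$. $\mathcal M^{\rm c}$ possesses the dichotomy property if for every $f\in L^1_{\rm loc}(\mu)$ either $\mu(\{\mathcal M^{\rm c}f=\infty\})=0$ or $\mathcal M^{\rm c}f(x)=\infty$ for all $x$. *)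

theory Defs
  imports "HOL-Analysis.Analysis"
begin

definition L1_loc :: "'a::euclidean_space measure \<Rightarrow> ('a \<Rightarrow> real) set" where
  "L1_loc \<mu> = {f. f \<in> borel_measurable \<mu> \<and> (\<forall>x r. set_integrable \<mu> (ball x r) f)}"

definition max_c :: "'a::euclidean_space measure \<Rightarrow> ('a \<Rightarrow> real) \<Rightarrow> 'a \<Rightarrow> ennreal" where
  "max_c \<mu> f x = (SUP r\<in>{0<..}. (\<integral>\<^sup>+ y\<in>ball x r. ennreal \<bar>f y\<bar> \<partial>\<mu>) / emeasure \<mu> (ball x r))"

definition dichotomy :: "'a::euclidean_space measure \<Rightarrow> bool" where
  "dichotomy \<mu> \<longleftrightarrow> (\<forall>f\<in>L1_loc \<mu>.
      (AE x in \<mu>. max_c \<mu> f x \<noteq> \<infinity>) \<or> (\<forall>x. max_c \<mu> f x = \<infinity>))"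

end

(*
  Growth condition implies dichotomy.  If M f is finite at one point, the growth condition compares
  large balls around that point with large balls around any other x, so only bounded radii can make
  M f x infinite.  For these a weak type (1,1) bound holds for every such measure: after reducing to
  finitely many rational radii, choose balls greedily by decreasing radius until all centers are
  covered.  No chosen ball contains the center of another, so two chosen balls containing a point y
  have centers seen from y at an angle of at least 60 degrees, and the overlap is bounded in terms
  of the dimension.

  Failure of the growth condition (at y0 = 0 only) breaks dichotomy.  There are radii r_j with
  mu(B_{r_j + 1}(0)) much larger than mu(B_{r_j}(0)); by pigeonhole, a fixed 60 degree cone around a
  unit vector theta contains a definite fraction of each shell.  Let f carry mass
  j mu(B_{r_j}(0)) near the antipodal point -r_j theta, just inside B_{r_j}(0).  Balls around points
  near 0 reach this mass while staying in B_{r_j}(0), so M f is infinite there, whereas a ball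
  around theta reaching it must contain the heavy part of the shell, so M f(theta) is finite.
*)
theory Submission
  imports Defs
begin

section \<open>Angles between separated centers and bounded overlap of balls\<close>

text \<open>In the triangle \<open>0\<close>, \<open>a\<close>, \<open>b\<close> the side from
  \<open>a\<close> to \<open>b\<close> is a longest one, so the angle at \<open>0\<close> is at
  least 60 degrees. The unit vectors then have inner product at most 1/2, and their chord has length
  at least 1.\<close>

lemma norm_sgn_diff_ge_1:
  fixes a b :: "'a::euclidean_space"
  assumes "a \<noteq> 0" "b \<noteq> 0" "norm a \<le> norm (a - b)" "norm b \<le> norm (a - b)"
  shows "1 \<le> norm (sgn a - sgn b)"
proof -
  have gen: "2 * (x \<bullet> y) \<le> norm x * norm y" if "norm y \<le> norm x" "norm x \<le> norm (x - y)" for x y :: 'a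
  proof -
    have "(norm x)\<^sup>2 \<le> (norm (x - y))\<^sup>2"
      using that by (simp add: power_mono)
    also have "\<dots> = (norm x)\<^sup>2 + (norm y)\<^sup>2 - 2 * (x \<bullet> y)"
      by (simp add: power2_norm_eq_inner inner_diff inner_commute)
    finally have "2 * (x \<bullet> y) \<le> norm y * norm y"
      by (simp add: power2_eq_square)
    also have "\<dots> \<le> norm x * norm y"
      using that by (simp add: mult_right_mono)
    finally show ?thesis .
  qed
  have "2 * (a \<bullet> b) \<le> norm a * norm b"
    using gen[of b a] gen[of a b] assms
    by (cases "norm b \<le> norm a") (simp_all add: norm_minus_commute inner_commute mult.commute)
  then have "2 * (sgn a \<bullet> sgn b) \<le> 1"
    using assms by (simp add: sgn_div_norm field_simps)
  moreover have "(norm (sgn a - sgn b))\<^sup>2 = (norm (sgn a))\<^sup>2 + (norm (sgn b))\<^sup>2 - 2 * (sgn a \<bullet> sgn b)"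
    by (simp add: power2_norm_eq_inner inner_diff inner_commute)
  ultimately have "1\<^sup>2 \<le> (norm (sgn a - sgn b))\<^sup>2"
    using assms by (simp add: norm_sgn)
  then show ?thesis
    by (rule power2_le_imp_le) simp
qed

lemma sphere_finite_net:
  fixes e :: real
  assumes "0 < e"
  obtains T :: "'a::euclidean_space set"
  where "finite T" "T \<subseteq> sphere 0 1" "sphere 0 1 \<subseteq> (\<Union>t\<in>T. ball t e)"
proof -
  have "compact (sphere (0::'a) 1)" by simp
  then obtain T where "T \<subseteq> sphere (0::'a) 1" "finite T" "sphere 0 1 \<subseteq> (\<Union>t\<in>T. ball t e)"
    using compactE_image[of "sphere (0::'a) 1" "sphere 0 1" "\<lambda>t. ball t e"] assms
    by (metis UN_I centre_in_ball open_ball subsetI)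
  then show thesis using that by blast
qed

text \<open>Seen from \<open>y\<close>, the centers of the balls containing \<open>y\<close> have
  directions at pairwise distance at least 1, so no two of them share a ball of radius 1/2 of a
  finite net of the unit sphere. A center equal to \<open>y\<close> has no direction, which costs
  one more. The net depends on the space alone, so \<open>N\<close> serves all \<open>S\<close>,
  \<open>r\<close> and \<open>y\<close>.\<close>

lemma bounded_overlap:
  obtains N :: nat where
    "\<And>(S :: 'a::euclidean_space set) r y. finite S \<Longrightarrow>
       (\<And>u v. u \<in> S \<Longrightarrow> v \<in> S \<Longrightarrow> u \<noteq> v \<Longrightarrow> r u \<le> dist u v) \<Longrightarrow>
       card {x \<in> S. y \<in> ball x (r x)} \<le> N"
proof -
  obtain T :: "'a set" where T: "finite T" "sphere 0 1 \<subseteq> (\<Union>t\<in>T. ball t (1/2))"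
    by (rule sphere_finite_net[of "1/2"]) auto
  have "card {x \<in> S. y \<in> ball x (r x)} \<le> Suc (card T)"
    if fin: "finite S" and sep: "\<And>u v. u \<in> S \<Longrightarrow> v \<in> S \<Longrightarrow> u \<noteq> v \<Longrightarrow> r u \<le> dist u v"
    for S :: "'a set" and r y
  proof -
    define Q where "Q = {x \<in> S. y \<in> ball x (r x)} - {y}"
    have "\<exists>t\<in>T. sgn (x - y) \<in> ball t (1/2)" if "x \<in> Q" for x
    proof -
      have "sgn (x - y) \<in> sphere 0 1" using that by (simp add: Q_def norm_sgn)
      then show ?thesis using T(2) by blast
    qed
    then obtain t where t: "\<And>x. x \<in> Q \<Longrightarrow> t x \<in> T \<and> sgn (x - y) \<in> ball (t x) (1/2)"
      by metis
    have "inj_on t Q"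
    proof (rule inj_onI, rule ccontr)
      fix u v assume uv: "u \<in> Q" "v \<in> Q" "t u = t v" "u \<noteq> v"
      have d: "dist u y < r u" "dist v y < r v" "r u \<le> dist u v" "r v \<le> dist v u"
        using uv sep[of u v] sep[of v u] by (auto simp: Q_def)
      have "1 \<le> norm (sgn (u - y) - sgn (v - y))"
        using uv d by (intro norm_sgn_diff_ge_1) (auto simp: Q_def dist_norm norm_minus_commute)
      moreover have "dist (sgn (u - y)) (sgn (v - y)) < 1"
        using t[OF uv(1)] t[OF uv(2)] uv(3) dist_triangle2[of "sgn (u - y)" "sgn (v - y)" "t u"]
        by (simp add: dist_commute)
      ultimately show False by (simp add: dist_norm)
    qed
    then have "card Q \<le> card T"
      using t T(1) by (intro card_inj_on_le[of t]) auto
    moreover have "card {x \<in> S. y \<in> ball x (r x)} \<le> card (insert y Q)"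
      using fin by (intro card_mono) (auto simp: Q_def)
    moreover have "card (insert y Q) \<le> Suc (card Q)"
      by (rule card_insert_le_m1) auto
    ultimately show ?thesis by linarith
  qed
  then show thesis using that by blast
qed

section \<open>Greedy selection of covering balls\<close>

lemma bounded_separated_finite:
  fixes S :: "'a::euclidean_space set"
  assumes "bounded S" "0 < e" "\<And>u v. u \<in> S \<Longrightarrow> v \<in> S \<Longrightarrow> u \<noteq> v \<Longrightarrow> e \<le> dist u v"
  shows "finite S"
proof (rule ccontr)
  assume "infinite S"
  then obtain x where "x islimpt S"
    using assms(1) Bolzano_Weierstrass_imp_closed bounded_infinite_imp_islimpt by blast
  then have "infinite (S \<inter> ball x (e/2))"
    using assms(2) islimpt_eq_infinite_ball by (metis half_gt_zero)
  then obtain u where u: "u \<in> S \<inter> ball x (e/2)" by (metis finite.emptyI ex_in_conv)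
  have "infinite (S \<inter> ball x (e/2) - {u})" using \<open>infinite (S \<inter> ball x (e/2))\<close> by simp
  then obtain v where v: "v \<in> S \<inter> ball x (e/2) - {u}" by (metis finite.emptyI ex_in_conv)
  have "dist u v < e" using u v dist_triangle_half_r[of x u e v] by auto
  then show False using assms(3)[of u v] u v by auto
qed

text \<open>A maximal \<open>e\<close>-separated subset, which exists by Zorn's lemma, covers
  \<open>A\<close> with balls of radius \<open>e\<close>: an uncovered point could be added to
  it.\<close>

lemma maximal_separated_subset:
  fixes A :: "'a::euclidean_space set"
  assumes "bounded A" "0 < e"
  obtains S where "finite S" "S \<subseteq> A" "A \<subseteq> (\<Union>x\<in>S. ball x e)"
    "\<And>u v. u \<in> S \<Longrightarrow> v \<in> S \<Longrightarrow> u \<noteq> v \<Longrightarrow> e \<le> dist u v"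
proof -
  define sep where "sep S \<longleftrightarrow> S \<subseteq> A \<and> (\<forall>u\<in>S. \<forall>v\<in>S. u \<noteq> v \<longrightarrow> e \<le> dist u v)" for S
  have "\<exists>M\<in>Collect sep. \<forall>X\<in>Collect sep. M \<subseteq> X \<longrightarrow> X = M"
  proof (rule subset_Zorn')
    fix C assume C: "subset.chain (Collect sep) C"
    then have sepC: "sep X" if "X \<in> C" for X
      using that by (auto simp: subset_chain_def)
    have "e \<le> dist u v" if uv: "u \<in> \<Union>C" "v \<in> \<Union>C" "u \<noteq> v" for u v
    proof -
      obtain X Y where XY: "X \<in> C" "u \<in> X" "Y \<in> C" "v \<in> Y" using uv(1,2) by blast
      then have "X \<subseteq> Y \<or> Y \<subseteq> X" using C by (simp add: subset_chain_def)
      then obtain Z where "Z \<in> C" "u \<in> Z" "v \<in> Z" using XY by blast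
      then show ?thesis using sepC[of Z] uv(3) by (simp add: sep_def)
    qed
    moreover have "\<Union>C \<subseteq> A" using sepC by (intro Union_least) (simp add: sep_def)
    ultimately show "\<Union>C \<in> Collect sep" unfolding sep_def by simp
  qed
  then obtain S where S: "sep S" "\<And>X. sep X \<Longrightarrow> S \<subseteq> X \<Longrightarrow> X = S" by auto
  have "A \<subseteq> (\<Union>x\<in>S. ball x e)"
  proof (rule ccontr)
    assume "\<not> A \<subseteq> (\<Union>x\<in>S. ball x e)"
    then obtain a where a: "a \<in> A" "\<And>x. x \<in> S \<Longrightarrow> e \<le> dist x a" by force
    then have "sep (insert a S)" using S(1) by (auto simp: dist_commute sep_def)
    then have "a \<in> S" using S(2)[of "insert a S"] by auto
    then show False using a(2)[of a] assms(2) by simp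
  qed
  moreover have "finite S"
    using S(1) assms bounded_subset by (intro bounded_separated_finite[of S e]) (auto simp: sep_def)
  ultimately show thesis using that S(1) by (simp add: sep_def)
qed

text \<open>Induction on the set of radii, removing the largest one, \<open>b\<close>. A maximal
  \<open>b\<close>-separated set is chosen among the points of radius \<open>b\<close>, and the
  induction hypothesis is applied to the points that its balls leave uncovered. Centers from the two
  stages are at distance at least \<open>b\<close>, which bounds every radius involved.\<close>

lemma greedy_ball_selection:
  fixes A :: "'a::euclidean_space set" and r :: "'a \<Rightarrow> real"
  assumes "finite F" "bounded A" "\<And>c. c \<in> F \<Longrightarrow> 0 < c" "\<And>x. x \<in> A \<Longrightarrow> r x \<in> F"
  shows "\<exists>S. finite S \<and> S \<subseteq> A \<and> A \<subseteq> (\<Union>x\<in>S. ball x (r x)) \<and>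
    (\<forall>u\<in>S. \<forall>v\<in>S. u \<noteq> v \<longrightarrow> r u \<le> dist u v)"
  using assms
proof (induction F arbitrary: A rule: finite_linorder_max_induct)
  case empty
  then show ?case by auto
next
  case (insert b F)
  define A1 where "A1 = {x \<in> A. r x = b}"
  obtain S1 where S1: "finite S1" "S1 \<subseteq> A1" "A1 \<subseteq> (\<Union>x\<in>S1. ball x b)"
      "\<And>u v. u \<in> S1 \<Longrightarrow> v \<in> S1 \<Longrightarrow> u \<noteq> v \<Longrightarrow> b \<le> dist u v"
    using maximal_separated_subset[of A1 b] insert.prems bounded_subset[of A A1]
    by (metis (no_types, lifting) A1_def insertI1 mem_Collect_eq subsetI)
  define A2 where "A2 = A - (\<Union>x\<in>S1. ball x b)"
  have "\<exists>S. finite S \<and> S \<subseteq> A2 \<and> A2 \<subseteq> (\<Union>x\<in>S. ball x (r x)) \<and>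
    (\<forall>u\<in>S. \<forall>v\<in>S. u \<noteq> v \<longrightarrow> r u \<le> dist u v)"
  proof (rule insert.IH)
    show "bounded A2" using insert.prems(1) by (rule bounded_subset) (auto simp: A2_def)
    \<comment> \<open>The balls around \<open>S1\<close> cover all points of radius
      \<open>b\<close>, so only smaller radii are left on \<open>A2\<close>.\<close>
    show "r x \<in> F" if "x \<in> A2" for x
      using that insert.prems(3)[of x] S1(3) by (auto simp: A2_def A1_def)
  qed (use insert.prems in auto)
  then obtain S2 where S2: "finite S2" "S2 \<subseteq> A2" "A2 \<subseteq> (\<Union>x\<in>S2. ball x (r x))"
    "\<And>u v. u \<in> S2 \<Longrightarrow> v \<in> S2 \<Longrightarrow> u \<noteq> v \<Longrightarrow> r u \<le> dist u v" by blast
  have rS1: "r u = b" if "u \<in> S1" for u using that S1(2) by (auto simp: A1_def)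
  have rS2: "r v \<le> b" if "v \<in> S2" for v
    using that S2(2) insert.prems(3)[of v] insert.hyps(2) by (force simp: A2_def)
  have cross: "b \<le> dist u v" if "u \<in> S1" "v \<in> S2" for u v
    using that S2(2) by (auto simp: A2_def not_less)
  have "r u \<le> dist u v" if "u \<in> S1 \<union> S2" "v \<in> S1 \<union> S2" "u \<noteq> v" for u v
    using that S1(4)[of u v] S2(4)[of u v] rS1[of u] rS2[of u] cross[of u v] cross[of v u]
    by (auto simp: dist_commute)
  moreover have "A \<subseteq> (\<Union>x\<in>S1 \<union> S2. ball x (r x))"
  proof
    fix x assume "x \<in> A"
    then consider "x \<in> (\<Union>x\<in>S1. ball x b)" | "x \<in> A2" by (auto simp: A2_def)
    then show "x \<in> (\<Union>x\<in>S1 \<union> S2. ball x (r x))"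
      using rS1 S2(3) by cases auto
  qed
  moreover have "S1 \<union> S2 \<subseteq> A" using S1(2) S2(2) by (auto simp: A1_def A2_def)
  ultimately show ?case using S1(1) S2(1) by (intro exI[of _ "S1 \<union> S2"]) auto
qed

section \<open>Weak type bound and null sets for bounded radii\<close>

text \<open>The sum of the indicators counts the sets containing a point: it is at most
  \<open>N\<close> on \<open>V\<close> and zero elsewhere. Integrating it gives the bound.\<close>

lemma sum_emeasure_le_overlap:
  assumes "finite S" "\<And>x. x \<in> S \<Longrightarrow> B x \<in> sets M" "\<And>x. x \<in> S \<Longrightarrow> B x \<subseteq> V" "V \<in> sets M"
    "\<And>y. card {x \<in> S. y \<in> B x} \<le> N"
  shows "(\<Sum>x\<in>S. emeasure M (B x)) \<le> of_nat N * emeasure M V"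
proof -
  have "(\<Sum>x\<in>S. emeasure M (B x)) = (\<Sum>x\<in>S. \<integral>\<^sup>+y. indicator (B x) y \<partial>M)"
    using assms(2) by (intro sum.cong) auto
  also have "\<dots> = (\<integral>\<^sup>+y. (\<Sum>x\<in>S. indicator (B x) y) \<partial>M)"
    using assms(2) by (intro nn_integral_sum[symmetric]) auto
  also have "\<dots> \<le> (\<integral>\<^sup>+y. of_nat N * indicator V y \<partial>M)"
  proof (rule nn_integral_mono)
    fix y
    have "(\<Sum>x\<in>S. indicator (B x) y) = (of_nat (card {x \<in> S. y \<in> B x}) :: ennreal)"
      using assms(1) by (simp add: indicator_def sum.If_cases Int_def)
    also have "\<dots> \<le> of_nat N * indicator V y"
    proof (cases "y \<in> V")
      case True
      then show ?thesis using assms(5)[of y] by simp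
    next
      case False
      then have "{x \<in> S. y \<in> B x} = {}" using assms(3) by blast
      then have "card {x \<in> S. y \<in> B x} = 0" by (simp only: card.empty)
      then show ?thesis by simp
    qed
    finally show "(\<Sum>x\<in>S. indicator (B x) y) \<le> (of_nat N * indicator V y :: ennreal)" .
  qed
  also have "\<dots> = of_nat N * emeasure M V"
    using assms(4) by (simp add: nn_integral_cmult)
  finally show ?thesis .
qed

text \<open>Greedily selected balls cover \<open>A\<close>, satisfy the comparison of the two
  measures one by one, and overlap at most \<open>N\<close> times inside
  \<open>ball 0 (2 * R)\<close>. It matters that \<open>N\<close> is fixed before \<open>F\<close>
  and \<open>c\<close>: the bound survives exhausting the rationals and letting \<open>c\<close>
  grow. As \<open>A\<close> is an arbitrary set, the estimate is stated for a Borel superset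
  \<open>U\<close>.\<close>

lemma weak_type_finite_radii:
  fixes \<mu> \<nu> :: "'a::euclidean_space measure"
  assumes sets: "sets \<mu> = sets borel" "sets \<nu> = sets borel"
  obtains N :: nat where
    "\<And>F A c R. finite F \<Longrightarrow> (\<And>t. t \<in> F \<Longrightarrow> 0 < t \<and> t \<le> R) \<Longrightarrow> A \<subseteq> ball 0 R \<Longrightarrow>
      (\<And>x. x \<in> A \<Longrightarrow> \<exists>t\<in>F. c * emeasure \<mu> (ball x t) \<le> emeasure \<nu> (ball x t)) \<Longrightarrow>
      \<exists>U\<in>sets borel. A \<subseteq> U \<and> c * emeasure \<mu> U \<le> of_nat N * emeasure \<nu> (ball 0 (2 * R))"
proof -
  obtain N :: nat where N: "\<And>(S :: 'a set) r y. finite S \<Longrightarrow>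
       (\<And>u v. u \<in> S \<Longrightarrow> v \<in> S \<Longrightarrow> u \<noteq> v \<Longrightarrow> r u \<le> dist u v) \<Longrightarrow>
       card {x \<in> S. y \<in> ball x (r x)} \<le> N"
    using bounded_overlap by blast
  have weak: "\<exists>U\<in>sets borel. A \<subseteq> U \<and> c * emeasure \<mu> U \<le> of_nat N * emeasure \<nu> (ball 0 (2 * R))"
    if F: "finite F" "\<And>t. t \<in> F \<Longrightarrow> 0 < t \<and> t \<le> R" and A: "A \<subseteq> ball 0 R"
      and E: "\<And>x. x \<in> A \<Longrightarrow> \<exists>t\<in>F. c * emeasure \<mu> (ball x t) \<le> emeasure \<nu> (ball x t)"
    for F A c R
  proof -
    obtain r where r: "\<And>x. x \<in> A \<Longrightarrow> r x \<in> F"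
        "\<And>x. x \<in> A \<Longrightarrow> c * emeasure \<mu> (ball x (r x)) \<le> emeasure \<nu> (ball x (r x))"
      using E by metis
    have "\<exists>S. finite S \<and> S \<subseteq> A \<and> A \<subseteq> (\<Union>x\<in>S. ball x (r x)) \<and>
        (\<forall>u\<in>S. \<forall>v\<in>S. u \<noteq> v \<longrightarrow> r u \<le> dist u v)"
      using F r(1) bounded_subset[OF bounded_ball A] by (intro greedy_ball_selection) auto
    then obtain S where S: "finite S" "S \<subseteq> A" "A \<subseteq> (\<Union>x\<in>S. ball x (r x))"
        "\<And>u v. u \<in> S \<Longrightarrow> v \<in> S \<Longrightarrow> u \<noteq> v \<Longrightarrow> r u \<le> dist u v"
      by blast
    have sub: "ball x (r x) \<subseteq> ball 0 (2 * R)" if "x \<in> S" for x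
    proof -
      have "dist 0 x < R" "r x \<le> R" using that S(2) A F(2) r(1) by (auto simp: subset_iff)
      then show ?thesis by (intro ball_subset_ball_iff[THEN iffD2]) (auto simp: dist_commute)
    qed
    have "c * emeasure \<mu> (\<Union>x\<in>S. ball x (r x)) \<le> c * (\<Sum>x\<in>S. emeasure \<mu> (ball x (r x)))"
      by (rule mult_left_mono, rule emeasure_subadditive_finite[OF S(1)]) (auto simp: sets)
    also have "\<dots> \<le> (\<Sum>x\<in>S. emeasure \<nu> (ball x (r x)))"
      using S(2) r(2) by (auto simp: sum_distrib_left intro!: sum_mono)
    also have "\<dots> \<le> of_nat N * emeasure \<nu> (ball 0 (2 * R))"
    proof (rule sum_emeasure_le_overlap)
      show "card {x \<in> S. y \<in> ball x (r x)} \<le> N" for y by (rule N[OF S(1) S(4)])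
    qed (use S(1) sub sets in auto)
    finally show ?thesis using S(3)
      by (intro bexI[of _ "\<Union>x\<in>S. ball x (r x)"] conjI borel_open open_UN ballI open_ball)
  qed
  show thesis by (rule that) (rule weak)
qed

text \<open>The measure of an open ball is continuous from the left in the radius, so the strict
  inequality leaves room to shrink \<open>t\<close> on the \<open>\<nu>\<close> side, while
  shrinking only decreases the \<open>\<mu>\<close> side. This reduces all radii to countably
  many.\<close>

lemma rational_radius:
  fixes \<mu> \<nu> :: "'a::euclidean_space measure"
  assumes sets: "sets \<mu> = sets borel" "sets \<nu> = sets borel"
    and "0 < t" "c * emeasure \<mu> (ball x t) < emeasure \<nu> (ball x t)"
  obtains q where "q \<in> \<rat>" "0 < q" "q < t" "c * emeasure \<mu> (ball x q) \<le> emeasure \<nu> (ball x q)"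
proof -
  define s where "s n = t - t / real (Suc n)" for n
  have s_mono: "incseq s" 
    unfolding incseq_def s_def using \<open>0 < t\<close> by (auto intro!: divide_left_mono)
  have s_lim: "s \<longlonglongrightarrow> t"
    unfolding s_def using tendsto_diff[OF tendsto_const tendsto_mult[OF tendsto_const LIMSEQ_inverse_real_of_nat], of t t]
    by (simp add: divide_inverse)
  have Un: "(\<Union>n. ball x (s n)) = ball x t"
  proof (intro equalityI subsetI)
    fix y assume "y \<in> (\<Union>n. ball x (s n))"
    then obtain n where "dist x y < s n" by auto
    moreover have "s n < t" using \<open>0 < t\<close> by (simp add: s_def)
    ultimately show "y \<in> ball x t" by simp
  next
    fix y assume "y \<in> ball x t"
    then have "eventually (\<lambda>n. dist x y < s n) sequentially"
      using order_tendstoD(1)[OF s_lim] by simp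
    then show "y \<in> (\<Union>n. ball x (s n))"
      by (metis (no_types, lifting) UN_I UNIV_I eventually_sequentially mem_ball order_refl)
  qed
  have "(\<lambda>n. emeasure \<nu> (ball x (s n))) \<longlonglongrightarrow> emeasure \<nu> (\<Union>n. ball x (s n))"
    using sets s_mono
    by (intro Lim_emeasure_incseq) (auto simp: incseq_def intro!: subset_ball dest: order.strict_trans2)
  then have "eventually (\<lambda>n. c * emeasure \<mu> (ball x t) < emeasure \<nu> (ball x (s n))) sequentially"
    unfolding Un using assms(4) by (rule order_tendstoD(1))
  moreover have "eventually (\<lambda>n. 0 < s n) sequentially"
    using order_tendstoD(1)[OF s_lim] \<open>0 < t\<close> by blast
  ultimately obtain n where n: "c * emeasure \<mu> (ball x t) < emeasure \<nu> (ball x (s n))" "0 < s n"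
    by (metis (no_types, lifting) eventually_conj_iff eventually_sequentially order_refl)
  have "s n < t" using \<open>0 < t\<close> by (simp add: s_def)
  then obtain q where q: "q \<in> \<rat>" "s n < q" "q < t" using Rats_dense_in_real by blast
  have "c * emeasure \<mu> (ball x q) \<le> c * emeasure \<mu> (ball x t)"
    using q sets by (intro mult_left_mono emeasure_mono subset_ball) auto
  also have "\<dots> \<le> emeasure \<nu> (ball x (s n))" using n by simp
  also have "\<dots> \<le> emeasure \<nu> (ball x q)"
    using q sets by (intro emeasure_mono subset_ball) auto
  finally show thesis using that[of q] q n(2) by auto
qed

lemma ennreal_zero_if_multiples_bounded:
  fixes a D :: ennreal
  assumes "\<And>k. 0 < k \<Longrightarrow> of_nat k * a \<le> D" "D < \<infinity>"
  shows "a = 0"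
proof (rule ccontr)
  assume "a \<noteq> 0"
  obtain d where d: "D = ennreal d" "0 \<le> d" using assms(2) by (cases D) auto
  have "a \<le> D" using assms(1)[of 1] by simp
  then obtain x where x: "a = ennreal x" "0 < x"
    using assms(2) \<open>a \<noteq> 0\<close> by (cases a) (auto simp: top_unique less_le)
  obtain k :: nat where k: "d < of_nat k * x" using reals_Archimedean3[OF x(2)] by blast
  then have "0 < k" using d(2) by (cases k) auto
  have "ennreal (real k * x) \<le> ennreal d"
    using assms(1)[OF \<open>0 < k\<close>] x d by (simp add: ennreal_mult ennreal_of_nat_eq_real_of_nat)
  then show False using k d by simp
qed

text \<open>For each positive \<open>k\<close>, the weak type bound puts the points where some
  average exceeds \<open>k\<close> into a Borel set of \<open>\<mu>\<close>-measure at most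
  \<open>D / k\<close>, with \<open>D\<close> finite and independent of \<open>k\<close>.
  Intersecting over \<open>k\<close> gives a null set \<open>W\<close>.\<close>

lemma local_maximal_infinite_null:
  fixes \<mu> \<nu> :: "'a::euclidean_space measure"
  assumes sets: "sets \<mu> = sets borel" "sets \<nu> = sets borel"
    and fin: "\<And>R. emeasure \<nu> (ball 0 R) < \<infinity>"
  obtains W where "W \<in> null_sets \<mu>"
    "{x \<in> ball 0 R. \<forall>k::nat. \<exists>t. 0 < t \<and> t < R \<and>
       of_nat k * emeasure \<mu> (ball x t) < emeasure \<nu> (ball x t)} \<subseteq> W"
proof -
  obtain N :: nat where N:
    "\<And>F A c R. finite F \<Longrightarrow> (\<And>t. t \<in> F \<Longrightarrow> 0 < t \<and> t \<le> R) \<Longrightarrow> A \<subseteq> ball 0 R \<Longrightarrow>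
      (\<And>x. x \<in> A \<Longrightarrow> \<exists>t\<in>F. c * emeasure \<mu> (ball x t) \<le> emeasure \<nu> (ball x t)) \<Longrightarrow>
      \<exists>U\<in>sets borel. A \<subseteq> U \<and> c * emeasure \<mu> U \<le> of_nat N * emeasure \<nu> (ball 0 (2 * R))"
    using weak_type_finite_radii[OF sets] by blast
  define D where "D = of_nat N * emeasure \<nu> (ball 0 (2 * R))"
  have "D < \<infinity>" using fin by (simp add: D_def ennreal_mult_less_top of_nat_less_top)
  \<comment> \<open>Increasing finite sets that exhaust the rationals in the interval from 0
    (excluded) to \<open>R\<close>.\<close>
  define F where "F n = {t \<in> (\<lambda>i. of_rat (nat_to_rat_surj i)) ` {..n}. 0 < t \<and> t \<le> R}" for n :: nat
  define A where "A k n = {x \<in> ball 0 R. \<exists>t\<in>F n. of_nat k * emeasure \<mu> (ball x t) \<le> emeasure \<nu> (ball x t)}"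
    for k n :: nat
  have "\<exists>U\<in>sets borel. A k n \<subseteq> U \<and> of_nat k * emeasure \<mu> U \<le> D" for k n
    unfolding D_def by (rule N[of "F n"]) (auto simp: F_def A_def)
  then obtain U where U: "\<And>k n. U k n \<in> sets borel" "\<And>k n. A k n \<subseteq> U k n"
      "\<And>k n. of_nat k * emeasure \<mu> (U k n) \<le> D"
    by metis
  have A_mono: "A k n \<subseteq> A k m" if "n \<le> m" for k n m
    using that by (fastforce simp: A_def F_def)
  \<comment> \<open>The supersets \<open>U k n\<close> were chosen independently and need not
    increase with \<open>n\<close>. Intersecting the later ones gives an increasing sequence that
    still contains \<open>A k n\<close>, since \<open>A k\<close> increases, so continuity from
    below carries the bound to the union.\<close>
  define V where "V k n = (\<Inter>m\<in>{n..}. U k m)" for k n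
  have V: "V k n \<in> sets borel" "A k n \<subseteq> V k n" for k n
  proof -
    show "V k n \<in> sets borel" unfolding V_def using U(1) by (intro sets.countable_INT') auto
    show "A k n \<subseteq> V k n" unfolding V_def using U(2) A_mono by blast
  qed
  have VU: "of_nat k * emeasure \<mu> (\<Union>n. V k n) \<le> D" for k
  proof -
    have "incseq (V k)" by (auto simp: incseq_def V_def)
    then have "emeasure \<mu> (\<Union>n. V k n) = (SUP n. emeasure \<mu> (V k n))"
      using V(1) sets by (intro SUP_emeasure_incseq[symmetric]) auto
    then have "of_nat k * emeasure \<mu> (\<Union>n. V k n) = (SUP n. of_nat k * emeasure \<mu> (V k n))"
      by (simp add: SUP_mult_left_ennreal)
    also have "\<dots> \<le> D"
    proof (rule SUP_least)
      fix n
      have "of_nat k * emeasure \<mu> (V k n) \<le> of_nat k * emeasure \<mu> (U k n)"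
        using U(1) sets by (intro mult_left_mono emeasure_mono) (auto simp: V_def)
      then show "of_nat k * emeasure \<mu> (V k n) \<le> D" using U(3)[of k n] by order
    qed
    finally show ?thesis .
  qed
  define W where "W = (\<Inter>k\<in>{0<..}. \<Union>n. V k n)"
  have Wm: "W \<in> sets borel"
    unfolding W_def using V(1) by (intro sets.countable_INT') auto
  have "emeasure \<mu> W = 0"
  proof (rule ennreal_zero_if_multiples_bounded[OF _ \<open>D < \<infinity>\<close>])
    fix k :: nat assume "0 < k"
    have "of_nat k * emeasure \<mu> W \<le> of_nat k * emeasure \<mu> (\<Union>n. V k n)"
      using \<open>0 < k\<close> sets V(1) by (intro mult_left_mono emeasure_mono) (auto simp: W_def)
    then show "of_nat k * emeasure \<mu> W \<le> D" using VU[of k] by order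
  qed
  then have "W \<in> null_sets \<mu>" using Wm sets by auto
  moreover have "x \<in> W" if x: "x \<in> ball 0 R"
    "\<And>k::nat. \<exists>t. 0 < t \<and> t < R \<and> of_nat k * emeasure \<mu> (ball x t) < emeasure \<nu> (ball x t)" for x
    unfolding W_def
  proof
    fix k :: nat
    obtain t where t: "0 < t" "t < R" "of_nat k * emeasure \<mu> (ball x t) < emeasure \<nu> (ball x t)"
      using x(2) by blast
    obtain q where q: "q \<in> \<rat>" "0 < q" "q < t" "of_nat k * emeasure \<mu> (ball x q) \<le> emeasure \<nu> (ball x q)"
      using rational_radius[OF sets t(1,3)] by blast
    obtain n where "q = of_rat (nat_to_rat_surj n)"
      using q(1) unfolding Rats_eq_range_of_rat_o_nat_to_rat_surj by auto
    then have "q \<in> F n" using q t by (auto simp: F_def)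
    then have "x \<in> A k n" using x(1) q by (auto simp: A_def)
    then show "x \<in> (\<Union>n. V k n)" using V(2) by blast
  qed
  ultimately show thesis by (intro that[of W]) auto
qed

section \<open>The growth condition implies dichotomy\<close>

lemma ratio_bounded_if_Limsup_finite:
  fixes g :: "real \<Rightarrow> real"
  assumes "Limsup at_top (\<lambda>r. ereal (g r)) < \<infinity>"
  obtains C where "eventually (\<lambda>r. g r \<le> C) at_top"
proof -
  obtain C :: real where "Limsup at_top (\<lambda>r. ereal (g r)) < ereal C"
    using assms less_PInf_Ex_of_nat by fastforce
  then have "eventually (\<lambda>r. ereal (g r) < ereal C) at_top"
    by (rule Limsup_lessD)
  then show thesis
    by (intro that[of C]) (auto elim: eventually_mono)
qed

lemma divide_le_ennreal_iff:
  fixes a b c :: ennreal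
  assumes "0 < b" "b < \<infinity>"
  shows "a / b \<le> c \<longleftrightarrow> a \<le> c * b"
proof
  assume "a / b \<le> c"
  then have "a / b * b \<le> c * b" by (rule mult_right_mono) simp
  then show "a \<le> c * b" using assms by (simp add: ennreal_divide_times)
next
  assume "a \<le> c * b"
  then have "a / b \<le> c * b / b" by (rule divide_right_mono_ennreal)
  then show "a / b \<le> c" using assms by (simp add: ennreal_times_divide[symmetric])
qed

lemma dichotomy_if_growth_bounded:
  fixes \<mu> :: "'a::euclidean_space measure"
  assumes sets: "sets \<mu> = sets borel"
    and pos: "\<And>x r. r > 0 \<Longrightarrow> 0 < emeasure \<mu> (ball x r) \<and> emeasure \<mu> (ball x r) < \<infinity>"
    and R0: "\<And>r. R0 \<le> r \<Longrightarrow> emeasure \<mu> (ball y0 (r + 1)) \<le> ennreal C * emeasure \<mu> (ball y0 r)"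
  shows "dichotomy \<mu>"
  unfolding dichotomy_def
proof (intro ballI disjCI)
  fix f assume f: "f \<in> L1_loc \<mu>" and "\<not> (\<forall>x. max_c \<mu> f x = \<infinity>)"
  then obtain x0 where x0: "max_c \<mu> f x0 < \<infinity>"
    using top.not_eq_extremum infinity_ennreal_def by metis
  define \<nu> where "\<nu> = density \<mu> (\<lambda>y. ennreal \<bar>f y\<bar>)"
  have sets\<nu>: "sets \<nu> = sets borel" by (simp add: \<nu>_def sets)
  have fm: "f \<in> borel_measurable \<mu>" using f by (simp add: L1_loc_def)
  have \<nu>: "emeasure \<nu> (ball x r) = (\<integral>\<^sup>+ y\<in>ball x r. ennreal \<bar>f y\<bar> \<partial>\<mu>)" for x r
    unfolding \<nu>_def using fm sets by (intro emeasure_density) auto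
  have \<nu>_fin: "emeasure \<nu> (ball x r) < \<infinity>" for x r
  proof -
    have "set_integrable \<mu> (ball x r) f" using f by (simp add: L1_loc_def)
    then have "(\<integral>\<^sup>+ y. ennreal (norm (indicator (ball x r) y *\<^sub>R f y)) \<partial>\<mu>) < \<infinity>"
      unfolding set_integrable_def by (simp add: integrable_iff_bounded)
    also have "(\<integral>\<^sup>+ y. ennreal (norm (indicator (ball x r) y *\<^sub>R f y)) \<partial>\<mu>) = emeasure \<nu> (ball x r)"
      unfolding \<nu> by (intro nn_integral_cong) (simp add: indicator_def)
    finally show ?thesis .
  qed
  have growth: "emeasure \<mu> (ball y0 (r + real k)) \<le> ennreal C ^ k * emeasure \<mu> (ball y0 r)"
    if "R0 \<le> r" for r k
  proof (induction k)
    case (Suc k)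
    have "emeasure \<mu> (ball y0 (r + real (Suc k))) \<le> ennreal C * emeasure \<mu> (ball y0 (r + real k))"
      using R0[of "r + real k"] that by (simp add: algebra_simps)
    also have "\<dots> \<le> ennreal C * (ennreal C ^ k * emeasure \<mu> (ball y0 r))"
      by (intro mult_left_mono Suc.IH) simp
    finally show ?case by (simp add: mult.assoc)
  qed simp
  have large: "\<exists>D<\<infinity>. \<exists>r0. \<forall>r\<ge>r0. emeasure \<nu> (ball x r) \<le> D * emeasure \<mu> (ball x r)" for x
  proof -
    define M where "M = max_c \<mu> f x0"
    \<comment> \<open>\<open>k\<close> pays for all shifts of center: \<open>ball x r\<close> lies
      in \<open>ball x0 (r + dist x x0)\<close>, which lies in the ball around \<open>y0\<close> of
      radius \<open>r - dist x y0 + k\<close>. After \<open>k\<close> growth steps back,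
      \<open>ball y0 (r - dist x y0)\<close> lies in \<open>ball x r\<close> again. The lower bound
      on \<open>r\<close> below keeps the shrunken radius at least \<open>R0\<close>.\<close>
    define k where "k = nat \<lceil>dist x x0 + dist x0 y0 + dist x y0\<rceil>"
    have k: "dist x x0 + dist x0 y0 + dist x y0 \<le> real k"
      unfolding k_def by linarith
    have "emeasure \<nu> (ball x r) \<le> (M * ennreal C ^ k) * emeasure \<mu> (ball x r)"
      if r: "max 1 (R0 + dist x y0) \<le> r" for r
    proof -
      have "emeasure \<nu> (ball x r) \<le> emeasure \<nu> (ball x0 (r + dist x x0))"
        using sets\<nu> by (intro emeasure_mono) (auto simp: ball_subset_ball_iff dist_commute)
      also have "\<dots> \<le> M * emeasure \<mu> (ball x0 (r + dist x x0))"
      proof -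
        have p: "0 < r + dist x x0" using r by (simp add: add_pos_nonneg)
        have "emeasure \<nu> (ball x0 (r + dist x x0)) / emeasure \<mu> (ball x0 (r + dist x x0)) \<le> M"
          unfolding M_def max_c_def \<nu> using p by (intro SUP_upper) simp
        then show ?thesis
          using pos[OF p, of x0] by (simp add: divide_le_ennreal_iff)
      qed
      also have "\<dots> \<le> M * emeasure \<mu> (ball y0 ((r - dist x y0) + real k))"
        using sets k r by (intro mult_left_mono emeasure_mono) (auto simp: ball_subset_ball_iff dist_commute)
      also have "\<dots> \<le> M * (ennreal C ^ k * emeasure \<mu> (ball y0 (r - dist x y0)))"
        using r by (intro mult_left_mono growth) auto
      also have "\<dots> \<le> M * (ennreal C ^ k * emeasure \<mu> (ball x r))"
        using sets by (intro mult_left_mono emeasure_mono) (auto simp: ball_subset_ball_iff dist_commute)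
      finally show ?thesis by (simp add: mult.assoc)
    qed
    moreover have "M * ennreal C ^ k < \<infinity>"
      using x0 by (simp add: M_def ennreal_mult_less_top power_less_top_ennreal)
    ultimately show ?thesis by blast
  qed
  define E where "E R = {x \<in> ball 0 R. \<forall>k::nat. \<exists>t. 0 < t \<and> t < R \<and>
       of_nat k * emeasure \<mu> (ball x t) < emeasure \<nu> (ball x t)}" for R
  have "\<exists>W. W \<in> null_sets \<mu> \<and> E R \<subseteq> W" for R
    unfolding E_def by (rule local_maximal_infinite_null[OF sets sets\<nu> \<nu>_fin, of R]) blast
  then obtain W where W: "\<And>R. W R \<in> null_sets \<mu>" "\<And>R. E R \<subseteq> W R"
    by metis
  show "AE x in \<mu>. max_c \<mu> f x \<noteq> \<infinity>"
  proof (rule AE_I')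
    show "(\<Union>n. W (real n)) \<in> null_sets \<mu>" using W(1) by auto
    show "{x \<in> space \<mu>. \<not> max_c \<mu> f x \<noteq> \<infinity>} \<subseteq> (\<Union>n. W (real n))"
    proof
      fix x assume "x \<in> {x \<in> space \<mu>. \<not> max_c \<mu> f x \<noteq> \<infinity>}"
      then have inf: "max_c \<mu> f x = \<infinity>" by simp
      obtain D r0 where D: "D < \<infinity>" "\<And>r. r0 \<le> r \<Longrightarrow> emeasure \<nu> (ball x r) \<le> D * emeasure \<mu> (ball x r)"
        using large[of x] by blast
      obtain l where l: "D < of_nat l" using ennreal_Ex_less_of_nat D(1) infinity_ennreal_def by metis
      obtain n :: nat where n: "max r0 (norm x) < real n" using reals_Archimedean2 by blast
      have "\<exists>t. 0 < t \<and> t < real n \<and> of_nat k * emeasure \<mu> (ball x t) < emeasure \<nu> (ball x t)" for k :: nat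
      proof -
        \<comment> \<open>Exceeding \<open>l\<close>, hence \<open>D\<close>, forces the radius
          below \<open>r0\<close>; exceeding \<open>k\<close> is what membership in
          \<open>E n\<close> asks for.\<close>
        have "of_nat (max k l) < max_c \<mu> f x" using inf of_nat_less_top by simp
        then obtain t where t: "0 < t" "of_nat (max k l) < emeasure \<nu> (ball x t) / emeasure \<mu> (ball x t)"
          unfolding max_c_def \<nu>[symmetric] less_SUP_iff by auto
        then have *: "of_nat (max k l) * emeasure \<mu> (ball x t) < emeasure \<nu> (ball x t)"
          using pos[OF t(1), of x] divide_le_ennreal_iff not_le by metis
        have "of_nat k * emeasure \<mu> (ball x t) \<le> of_nat (max k l) * emeasure \<mu> (ball x t)"
          by (intro mult_right_mono) auto
        moreover have "t < r0"
        proof (rule ccontr)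
          assume "\<not> t < r0"
          then have "emeasure \<nu> (ball x t) \<le> D * emeasure \<mu> (ball x t)" using D(2) by simp
          also have "\<dots> \<le> of_nat (max k l) * emeasure \<mu> (ball x t)"
          proof (intro mult_right_mono)
            have "of_nat l \<le> (of_nat (max k l) :: ennreal)" by simp
            then show "D \<le> of_nat (max k l)" using l by order
          qed simp
          finally show False using * by simp
        qed
        ultimately show ?thesis using * t(1) n by (intro exI[of _ t]) auto
      qed
      then have "x \<in> W (real n)" using W(2)[of "real n"] n by (auto simp: E_def)
      then show "x \<in> (\<Union>n. W (real n))" by blast
    qed
  qed
qed

section \<open>Cone shells and a direction of heavy growth\<close>

text \<open>For a unit vector \<open>\<theta>\<close> the last condition says that the angle between
  \<open>y\<close> and \<open>\<theta>\<close> is at most 60 degrees, written without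
  division.\<close>

definition cone_shell :: "'a::euclidean_space \<Rightarrow> real \<Rightarrow> 'a set" where
  "cone_shell \<theta> r = {y \<in> ball 0 (r + 1). r \<le> norm y \<and> norm y \<le> 2 * (y \<bullet> \<theta>)}"

lemma cone_shell_measurable [measurable]: "cone_shell \<theta> r \<in> sets borel"
proof -
  have "cone_shell \<theta> r = ball 0 (r + 1) \<inter> {y. r \<le> norm y} \<inter> {y. norm y \<le> 2 * (y \<bullet> \<theta>)}"
    by (auto simp: cone_shell_def)
  moreover have "closed {y::'a. r \<le> norm y}" "closed {y::'a. norm y \<le> 2 * (y \<bullet> \<theta>)}"
    by (intro closed_Collect_le continuous_intros)+
  ultimately show ?thesis
    by (simp add: borel_closed borel_open sets.Int)
qed

text \<open>Two unit vectors at distance less than 1 have inner product above 1/2, so the direction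
  of any point of the shell falls into the cone around some vector of the net.\<close>

lemma ball_subset_cone_shells:
  fixes T :: "'a::euclidean_space set"
  assumes T: "T \<subseteq> sphere 0 1" "sphere 0 1 \<subseteq> (\<Union>t\<in>T. ball t 1)" and "0 < r"
  shows "ball 0 (r + 1) \<subseteq> ball 0 r \<union> (\<Union>\<theta>\<in>T. cone_shell \<theta> r)"
proof
  fix y :: 'a assume y: "y \<in> ball 0 (r + 1)"
  show "y \<in> ball 0 r \<union> (\<Union>\<theta>\<in>T. cone_shell \<theta> r)"
  proof (cases "norm y < r")
    case False
    then have "y \<noteq> 0" using \<open>0 < r\<close> by auto
    then have "sgn y \<in> sphere 0 1" by (simp add: norm_sgn)
    then obtain \<theta> where \<theta>: "\<theta> \<in> T" "dist \<theta> (sgn y) < 1" using T(2) by auto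
    have "norm \<theta> = 1" using T(1) \<theta>(1) by auto
    have "(norm (sgn y - \<theta>))\<^sup>2 < 1\<^sup>2"
      using \<theta>(2) by (intro power_strict_mono) (auto simp: dist_norm norm_minus_commute)
    moreover have "(norm (sgn y - \<theta>))\<^sup>2 = (norm (sgn y))\<^sup>2 + (norm \<theta>)\<^sup>2 - 2 * (sgn y \<bullet> \<theta>)"
      by (simp add: power2_norm_eq_inner inner_diff inner_commute)
    ultimately have "1 < 2 * (sgn y \<bullet> \<theta>)"
      using \<open>norm \<theta> = 1\<close> \<open>y \<noteq> 0\<close> by (simp add: norm_sgn)
    then have "norm y \<le> 2 * (y \<bullet> \<theta>)"
      using \<open>y \<noteq> 0\<close> by (simp add: sgn_div_norm field_simps)
    then show ?thesis using y False \<theta>(1) by (auto simp: cone_shell_def)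
  qed simp
qed

text \<open>By the law of cosines the squared distance from \<open>y\<close> to
  \<open>\<theta>\<close> is at most \<open>r * (r + 1) + 1\<close>, so its root is about
  \<open>r + 1/2\<close>: moving the center by 1 towards the cone saves about half a unit of radius.
  The value 3/4 is the one needed in the counterexample.\<close>

lemma cone_shell_subset_ball:
  assumes "norm \<theta> = 1" "2 \<le> r"
  shows "cone_shell \<theta> r \<subseteq> ball \<theta> (r + 3/4)"
proof
  fix y assume "y \<in> cone_shell \<theta> r"
  then have y: "norm y < r + 1" "r \<le> norm y" "norm y \<le> 2 * (y \<bullet> \<theta>)" by (auto simp: cone_shell_def)
  have "(norm (y - \<theta>))\<^sup>2 = (norm y)\<^sup>2 + (norm \<theta>)\<^sup>2 - 2 * (y \<bullet> \<theta>)"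
    by (simp add: power2_norm_eq_inner inner_diff inner_commute)
  also have "\<dots> \<le> norm y * (norm y - 1) + 1"
    using y assms by (simp add: power2_eq_square algebra_simps)
  also have "\<dots> \<le> (r + 1) * r + 1"
    using y assms by (intro add_right_mono mult_mono) auto
  also have "\<dots> < (r + 3/4)\<^sup>2"
    using assms by (simp add: power2_eq_square algebra_simps)
  finally have "norm (y - \<theta>) < r + 3/4"
    using assms by (intro power2_less_imp_less[of "norm (y - \<theta>)" "r + 3/4"]) auto
  then show "y \<in> ball \<theta> (r + 3/4)" by (simp add: dist_norm norm_minus_commute)
qed

text \<open>Pigeonhole twice over a finite net: for each \<open>j\<close> some direction is heavy,
  and since heaviness at \<open>j\<close> with a radius implies heaviness at every smaller index
  with the same radius, one direction serves all \<open>j\<close>. In the factor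
  \<open>j * 2 ^ j\<close>, the \<open>j\<close> makes averages blow up near 0 and the
  \<open>2 ^ j\<close> makes the contributions at \<open>\<theta>\<close> summable.\<close>

lemma heavy_cone_direction:
  fixes \<mu> :: "'a::euclidean_space measure"
  assumes sets: "sets \<mu> = sets borel"
    and pos: "\<And>x r. r > 0 \<Longrightarrow> 0 < emeasure \<mu> (ball x r) \<and> emeasure \<mu> (ball x r) < \<infinity>"
    and unbounded: "\<And>M R :: nat. \<exists>r\<ge>real R. of_nat M * emeasure \<mu> (ball 0 r) < emeasure \<mu> (ball 0 (r + 1))"
  obtains \<theta> :: 'a and r :: "nat \<Rightarrow> real"
  where "norm \<theta> = 1" "\<And>j. real j + 2 \<le> r j"
    "\<And>j. of_nat (j * 2 ^ j) * emeasure \<mu> (ball 0 (r j)) \<le> emeasure \<mu> (cone_shell \<theta> (r j))"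
proof -
  obtain T :: "'a set" where T: "finite T" "T \<subseteq> sphere 0 1" "sphere 0 1 \<subseteq> (\<Union>t\<in>T. ball t 1)"
    by (rule sphere_finite_net[of 1]) auto
  define P where "P j \<theta> r \<longleftrightarrow> real j + 2 \<le> r \<and>
      of_nat (j * 2 ^ j) * emeasure \<mu> (ball 0 r) \<le> emeasure \<mu> (cone_shell \<theta> r)"
    for j :: nat and \<theta> r
  have ex: "\<exists>\<theta>\<in>T. \<exists>r. P j \<theta> r" for j
  proof (rule ccontr)
    assume neg: "\<not> (\<exists>\<theta>\<in>T. \<exists>r. P j \<theta> r)"
    define K where "K = j * 2 ^ j"
    \<comment> \<open>The 1 accounts for the inner ball, and each of the \<open>card T\<close> cone
      shells would add at most \<open>K\<close> if none were heavy.\<close>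
    obtain r where r: "real (j + 2) \<le> r"
      "of_nat (1 + card T * K) * emeasure \<mu> (ball 0 r) < emeasure \<mu> (ball 0 (r + 1))"
      using unbounded by blast
    have Un: "(\<Union>\<theta>\<in>T. cone_shell \<theta> r) \<in> sets \<mu>"
      using T(1) by (intro sets.finite_UN) (auto simp: sets)
    have "emeasure \<mu> (ball 0 (r + 1)) \<le> emeasure \<mu> (ball 0 r \<union> (\<Union>\<theta>\<in>T. cone_shell \<theta> r))"
      using r(1) sets Un ball_subset_cone_shells[OF T(2,3), of r]
      by (intro emeasure_mono sets.Un) auto
    also have "\<dots> \<le> emeasure \<mu> (ball 0 r) + emeasure \<mu> (\<Union>\<theta>\<in>T. cone_shell \<theta> r)"
      using sets Un by (intro emeasure_subadditive) auto
    also have "\<dots> \<le> emeasure \<mu> (ball 0 r) + (\<Sum>\<theta>\<in>T. emeasure \<mu> (cone_shell \<theta> r))"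
      by (rule add_left_mono, rule emeasure_subadditive_finite[OF T(1)]) (auto simp: sets)
    also have "\<dots> \<le> emeasure \<mu> (ball 0 r) + (\<Sum>\<theta>\<in>T. of_nat K * emeasure \<mu> (ball 0 r))"
    proof (intro add_left_mono sum_mono)
      fix \<theta> assume "\<theta> \<in> T"
      then have "\<not> P j \<theta> r" using neg by blast
      moreover have "real j + 2 \<le> r" using r(1) by simp
      ultimately show "emeasure \<mu> (cone_shell \<theta> r) \<le> of_nat K * emeasure \<mu> (ball 0 r)"
        unfolding P_def K_def by (meson linear)
    qed
    also have "\<dots> = of_nat (1 + card T * K) * emeasure \<mu> (ball 0 r)"
      by (simp add: algebra_simps)
    finally show False using r(2) by simp
  qed
  have P_mono: "P i \<theta> r" if "P j \<theta> r" "i \<le> j" for i j \<theta> r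
  proof -
    have "(of_nat (i * 2 ^ i) :: ennreal) \<le> of_nat (j * 2 ^ j)"
      using that(2) by (intro of_nat_mono mult_mono power_increasing) auto
    then have "of_nat (i * 2 ^ i) * emeasure \<mu> (ball 0 r) \<le> of_nat (j * 2 ^ j) * emeasure \<mu> (ball 0 r)"
      by (intro mult_right_mono) auto
    then show ?thesis using that unfolding P_def by force
  qed
  have "\<exists>\<theta>\<in>T. \<forall>j. \<exists>r. P j \<theta> r"
  proof (rule ccontr)
    assume "\<not> ?thesis"
    then obtain J where J: "\<And>\<theta>. \<theta> \<in> T \<Longrightarrow> \<not> (\<exists>r. P (J \<theta>) \<theta> r)" by metis
    obtain \<theta> r where \<theta>: "\<theta> \<in> T" "P (Max (J ` T)) \<theta> r" using ex by blast
    have "J \<theta> \<le> Max (J ` T)" using T(1) \<theta>(1) by simp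
    then show False using P_mono[OF \<theta>(2)] J[OF \<theta>(1)] by blast
  qed
  then obtain \<theta> r where "\<theta> \<in> T" "\<And>j. P j \<theta> (r j)" by metis
  then show thesis using T(2) by (intro that[of \<theta> r]) (auto simp: P_def)
qed

section \<open>Unbounded growth at the origin breaks dichotomy\<close>

lemma max_c_top_if_averages_unbounded:
  assumes "\<And>j::nat. \<exists>r>0. of_nat j * emeasure \<mu> (ball x r) \<le> (\<integral>\<^sup>+ y\<in>ball x r. ennreal \<bar>f y\<bar> \<partial>\<mu>)"
    and pos: "\<And>r. r > 0 \<Longrightarrow> 0 < emeasure \<mu> (ball x r) \<and> emeasure \<mu> (ball x r) < \<infinity>"
  shows "max_c \<mu> f x = \<infinity>"
proof (rule ccontr)
  assume "max_c \<mu> f x \<noteq> \<infinity>"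
  then obtain j :: nat where j: "max_c \<mu> f x < of_nat j"
    using ennreal_Ex_less_of_nat top.not_eq_extremum infinity_ennreal_def by metis
  obtain r where r: "0 < r" "of_nat j * emeasure \<mu> (ball x r) \<le> (\<integral>\<^sup>+ y\<in>ball x r. ennreal \<bar>f y\<bar> \<partial>\<mu>)"
    using assms(1) by blast
  have "emeasure \<mu> (ball x r) / emeasure \<mu> (ball x r) = 1"
    using pos[OF r(1)] by (intro ennreal_divide_self) auto
  then have "of_nat j = of_nat j * emeasure \<mu> (ball x r) / emeasure \<mu> (ball x r)"
    by (metis ennreal_times_divide mult.right_neutral)
  also have "\<dots> \<le> (\<integral>\<^sup>+ y\<in>ball x r. ennreal \<bar>f y\<bar> \<partial>\<mu>) / emeasure \<mu> (ball x r)"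
    using r(2) by (rule divide_right_mono_ennreal)
  also have "\<dots> \<le> max_c \<mu> f x"
    unfolding max_c_def using r(1) by (intro SUP_upper) simp
  finally show False using j by simp
qed

lemma not_dichotomy_if_growth_unbounded:
  fixes \<mu> :: "'a::euclidean_space measure"
  assumes sets: "sets \<mu> = sets borel"
    and pos: "\<And>x r. r > 0 \<Longrightarrow> 0 < emeasure \<mu> (ball x r) \<and> emeasure \<mu> (ball x r) < \<infinity>"
    and unbounded: "\<And>M R :: nat. \<exists>r\<ge>real R. of_nat M * emeasure \<mu> (ball 0 r) < emeasure \<mu> (ball 0 (r + 1))"
  shows "\<not> dichotomy \<mu>"
proof -
  obtain \<theta> :: 'a and r :: "nat \<Rightarrow> real" where \<theta>: "norm \<theta> = 1" and r: "\<And>j. real j + 2 \<le> r j"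
    and heavy: "\<And>j. of_nat (j * 2 ^ j) * emeasure \<mu> (ball 0 (r j)) \<le> emeasure \<mu> (cone_shell \<theta> (r j))"
    by (rule heavy_cone_direction[OF sets]) (rule pos, assumption, rule unbounded, rule that)
  have [measurable]: "ball x t \<in> sets \<mu>" for x t using sets by simp
  have space: "space \<mu> = UNIV" using sets_eq_imp_space_eq[OF sets] by simp
  have r2: "2 \<le> r j" for j using r[of j] by simp
  \<comment> \<open>With depth 3/16 and radius 1/16, a point within 1/16 of the origin is at
    distance less than \<open>r j - 1/16\<close> from all of \<open>b j\<close>. From
    \<open>\<theta>\<close>, every point of \<open>b j\<close> is farther than
    \<open>r j + 3/4\<close>, the radius that captures the cone shell.\<close>
  define q where "q j = - ((r j - 3/16) *\<^sub>R \<theta>)" for j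
  define b where "b j = ball (q j) (1/16)" for j
  have bm [measurable]: "b j \<in> sets \<mu>" for j by (simp add: b_def)
  have b_pos: "0 < emeasure \<mu> (b j)" "emeasure \<mu> (b j) < \<infinity>" for j
    using pos[of "1/16" "q j"] by (auto simp: b_def)
  \<comment> \<open>\<open>m j\<close> is the mass placed on \<open>b j\<close>, and
    \<open>a j\<close> is the constant height that realizes it.\<close>
  define m where "m j = real j * measure \<mu> (ball 0 (r j))" for j
  define a where "a j = m j / measure \<mu> (b j)" for j
  have a_nonneg: "0 \<le> a j" for j by (simp add: a_def m_def)
  have m_eq: "ennreal (m j) = of_nat j * emeasure \<mu> (ball 0 (r j))" for j
    using pos[of "r j" 0] r2[of j]
    by (simp add: m_def ennreal_mult ennreal_of_nat_eq_real_of_nat emeasure_eq_ennreal_measure less_top)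
  have ab: "ennreal (a j) * emeasure \<mu> (b j) = ennreal (m j)" for j
  proof -
    have e: "emeasure \<mu> (b j) = ennreal (measure \<mu> (b j))"
      using b_pos(2)[of j] by (intro emeasure_eq_ennreal_measure) auto
    then have "measure \<mu> (b j) \<noteq> 0" using b_pos(1)[of j] by auto
    then show ?thesis unfolding e using a_nonneg by (simp add: a_def ennreal_mult[symmetric])
  qed
  define f where "f y = (\<Sum>j. a j * indicator (b j) y)" for y :: 'a
  have norm_q: "norm (q j) = r j - 3/16" for j
    using \<theta> r2[of j] by (simp add: q_def)
  \<comment> \<open>As \<open>r j\<close> is at least \<open>j + 2\<close>, the bumps escape to
    infinity. Each ball meets only finitely many of them, which makes \<open>f\<close> a finite sum
    at each point and locally integrable. The bumps may overlap.\<close>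
  have b_far: "real j < norm y" if "y \<in> b j" for j y
  proof -
    have "norm (q j) \<le> norm y + dist (q j) y"
      by (metis add.commute dist_0_norm dist_commute dist_triangle)
    then show ?thesis using that r[of j] norm_q[of j] by (simp add: b_def)
  qed
  have summable: "summable (\<lambda>j. a j * indicator (b j) y)" for y :: 'a
  proof (rule summable_finite)
    show "finite {..nat \<lceil>norm y\<rceil>}" by simp
    show "a j * indicator (b j) y = 0" if "j \<notin> {..nat \<lceil>norm y\<rceil>}" for j
    proof -
      have "y \<notin> b j"
      proof
        assume "y \<in> b j"
        then have "real j < norm y" by (rule b_far)
        then have "j \<le> nat \<lceil>norm y\<rceil>" by linarith
        then show False using that by simp
      qed
      then show ?thesis by simp
    qed
  qed
  have f_abs: "ennreal \<bar>f y\<bar> = (\<Sum>j. ennreal (a j) * indicator (b j) y)" for y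
  proof -
    have "0 \<le> f y" unfolding f_def using a_nonneg by (intro suminf_nonneg summable) auto
    then have "ennreal \<bar>f y\<bar> = (\<Sum>j. ennreal (a j * indicator (b j) y))"
      unfolding f_def using a_nonneg by (subst suminf_ennreal2[OF _ summable]) auto
    also have "\<dots> = (\<Sum>j. ennreal (a j) * indicator (b j) y)"
      by (intro suminf_cong) (simp add: indicator_def)
    finally show ?thesis .
  qed
  have f_int: "(\<integral>\<^sup>+ y\<in>ball x s. ennreal \<bar>f y\<bar> \<partial>\<mu>) = (\<Sum>j. ennreal (a j) * emeasure \<mu> (b j \<inter> ball x s))"
    for x s
  proof -
    have "(\<integral>\<^sup>+ y\<in>ball x s. ennreal \<bar>f y\<bar> \<partial>\<mu>) = (\<integral>\<^sup>+ y. (\<Sum>j. ennreal (a j) * indicator (b j \<inter> ball x s) y) \<partial>\<mu>)"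
      by (intro nn_integral_cong) (simp add: f_abs indicator_def)
    also have "\<dots> = (\<Sum>j. \<integral>\<^sup>+ y. ennreal (a j) * indicator (b j \<inter> ball x s) y \<partial>\<mu>)"
      by (intro nn_integral_suminf) measurable
    also have "\<dots> = (\<Sum>j. ennreal (a j) * emeasure \<mu> (b j \<inter> ball x s))"
      by (intro suminf_cong nn_integral_cmult_indicator) measurable
    finally show ?thesis .
  qed
  have term_le: "ennreal (a j) * emeasure \<mu> (b j \<inter> ball x s) \<le> ennreal (m j)" for j x s
    unfolding ab[symmetric] by (intro mult_left_mono emeasure_mono) auto
  have f_fin: "(\<integral>\<^sup>+ y\<in>ball x s. ennreal \<bar>f y\<bar> \<partial>\<mu>) < \<infinity>" for x s
  proof -
    define J where "J = {..nat \<lceil>norm x + s\<rceil>}"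
    have "b j \<inter> ball x s = {}" if "j \<notin> J" for j
    proof (rule ccontr)
      assume "b j \<inter> ball x s \<noteq> {}"
      then obtain y where y: "y \<in> b j" "dist x y < s" by auto
      have "norm y \<le> norm x + dist x y"
        by (metis dist_0_norm dist_triangle)
      then have "j \<le> nat \<lceil>norm x + s\<rceil>" using b_far[OF y(1)] y(2) by linarith
      then show False using that by (simp add: J_def)
    qed
    then have "(\<integral>\<^sup>+ y\<in>ball x s. ennreal \<bar>f y\<bar> \<partial>\<mu>) = (\<Sum>j\<in>J. ennreal (a j) * emeasure \<mu> (b j \<inter> ball x s))"
      unfolding f_int by (intro suminf_finite) (auto simp: J_def)
    also have "\<dots> \<le> (\<Sum>j\<in>J. ennreal (m j))" by (intro sum_mono term_le)
    also have "\<dots> < \<infinity>" by (simp add: sum_ennreal m_def)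
    finally show ?thesis .
  qed
  have fm [measurable]: "f \<in> borel_measurable \<mu>"
    unfolding f_def by measurable
  have "f \<in> L1_loc \<mu>"
    unfolding L1_loc_def set_integrable_def
  proof (intro CollectI conjI allI fm integrableI_bounded)
    fix x s
    show "(\<lambda>y. indicat_real (ball x s) y *\<^sub>R f y) \<in> borel_measurable \<mu>" by measurable
    have "(\<integral>\<^sup>+ y. ennreal (norm (indicat_real (ball x s) y *\<^sub>R f y)) \<partial>\<mu>) = (\<integral>\<^sup>+ y\<in>ball x s. ennreal \<bar>f y\<bar> \<partial>\<mu>)"
      by (intro nn_integral_cong) (simp add: indicator_def)
    then show "(\<integral>\<^sup>+ y. ennreal (norm (indicat_real (ball x s) y *\<^sub>R f y)) \<partial>\<mu>) < \<infinity>"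
      using f_fin by simp
  qed
  have "max_c \<mu> f \<theta> \<le> 2"
    unfolding max_c_def
  proof (rule SUP_least)
    fix s :: real assume "s \<in> {0<..}"
    then have s: "0 < s" by simp
    \<comment> \<open>A ball around \<open>\<theta>\<close> that meets \<open>b j\<close> has radius
      above \<open>r j + 3/4\<close>, so it contains the cone shell, whose measure is at least
      \<open>2 ^ j * m j\<close>. Summing the geometric series gives the bound 2.\<close>
    have "ennreal (a j) * emeasure \<mu> (b j \<inter> ball \<theta> s) \<le> ennreal ((1/2) ^ j) * emeasure \<mu> (ball \<theta> s)" for j
    proof (cases "b j \<inter> ball \<theta> s = {}")
      case False
      then obtain z where z: "z \<in> b j" "dist \<theta> z < s" by auto
      have "dist \<theta> (q j) = norm ((1 + (r j - 3/16)) *\<^sub>R \<theta>)"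
        unfolding dist_norm q_def scaleR_left_distrib by simp
      also have "\<dots> = r j + 13/16" using \<theta> r2[of j] by simp
      finally have "r j + 3/4 < s"
        using z dist_triangle[of \<theta> "q j" z] by (simp add: b_def dist_commute)
      then have "cone_shell \<theta> (r j) \<subseteq> ball \<theta> s"
        using cone_shell_subset_ball[OF \<theta> r2] subset_ball[of "r j + 3/4" s \<theta>] by fastforce
      have "of_nat (2 ^ j) * ennreal (m j) = of_nat (j * 2 ^ j) * emeasure \<mu> (ball 0 (r j))"
        by (simp add: m_eq mult_ac)
      also have "\<dots> \<le> emeasure \<mu> (cone_shell \<theta> (r j))" by (rule heavy)
      also have "\<dots> \<le> emeasure \<mu> (ball \<theta> s)"
        using \<open>cone_shell \<theta> (r j) \<subseteq> ball \<theta> s\<close> by (intro emeasure_mono) auto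
      finally have le: "of_nat (2 ^ j) * ennreal (m j) \<le> emeasure \<mu> (ball \<theta> s)" .
      have "ennreal ((1/2) ^ j) * of_nat (2 ^ j) = ennreal ((1/2) ^ j * 2 ^ j)"
        unfolding ennreal_of_nat_eq_real_of_nat by (subst ennreal_mult) auto
      also have "\<dots> = 1" by (simp flip: power_mult_distrib)
      finally have "ennreal (m j) = ennreal ((1/2) ^ j) * (of_nat (2 ^ j) * ennreal (m j))"
        by (metis mult.assoc mult_1)
      also have "\<dots> \<le> ennreal ((1/2) ^ j) * emeasure \<mu> (ball \<theta> s)"
        using le by (intro mult_left_mono) auto
      finally show ?thesis using term_le[of j \<theta> s] by order
    qed simp
    then have "(\<integral>\<^sup>+ y\<in>ball \<theta> s. ennreal \<bar>f y\<bar> \<partial>\<mu>) \<le> (\<Sum>j. ennreal ((1/2) ^ j) * emeasure \<mu> (ball \<theta> s))"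
      unfolding f_int by (intro suminf_le) auto
    also have "\<dots> = (\<Sum>j. ennreal ((1/2) ^ j)) * emeasure \<mu> (ball \<theta> s)" by simp
    also have "(\<Sum>j. ennreal ((1/2) ^ j)) = ennreal 2"
      by (subst suminf_ennreal2) (auto simp: suminf_geometric)
    finally show "(\<integral>\<^sup>+ y\<in>ball \<theta> s. ennreal \<bar>f y\<bar> \<partial>\<mu>) / emeasure \<mu> (ball \<theta> s) \<le> 2"
      using pos[OF s, of \<theta>] by (simp add: divide_le_ennreal_iff)
  qed
  then have fin: "max_c \<mu> f \<theta> \<noteq> \<infinity>" by (auto simp: top_unique)
  \<comment> \<open>This ball has positive measure, so the almost everywhere alternative fails,
    while finiteness at \<open>\<theta>\<close> excludes the other one.\<close>
  have inf: "max_c \<mu> f p = \<infinity>" if p: "p \<in> ball 0 (1/16)" for p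
  proof (rule max_c_top_if_averages_unbounded)
    fix j :: nat
    \<comment> \<open>The largest radius for which every \<open>ball p s\<close> with
      \<open>p\<close> in \<open>ball 0 (1/16)\<close> stays inside \<open>ball 0 (r j)\<close> by
      the triangle inequality.\<close>
    define s where "s = r j - 1/16"
    have "s > 0" using r2[of j] by (simp add: s_def)
    have "b j \<subseteq> ball p s"
    proof
      fix y assume "y \<in> b j"
      then have "dist (q j) y < 1/16" by (simp add: b_def)
      moreover have "dist p (q j) \<le> norm p + norm (q j)" by (simp add: dist_norm norm_triangle_ineq4)
      ultimately show "y \<in> ball p s"
        using p norm_q[of j] dist_triangle[of p y "q j"] by (simp add: s_def)
    qed
    then have "b j \<inter> ball p s = b j" by blast
    have "of_nat j * emeasure \<mu> (ball p s) \<le> of_nat j * emeasure \<mu> (ball 0 (r j))"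
      using p by (intro mult_left_mono emeasure_mono) (auto simp: ball_subset_ball_iff s_def)
    also have "\<dots> = ennreal (a j) * emeasure \<mu> (b j \<inter> ball p s)"
      using \<open>b j \<inter> ball p s = b j\<close> by (simp add: ab m_eq)
    also have "\<dots> \<le> (\<integral>\<^sup>+ y\<in>ball p s. ennreal \<bar>f y\<bar> \<partial>\<mu>)"
      unfolding f_int using sum_le_suminf[of "\<lambda>j. ennreal (a j) * emeasure \<mu> (b j \<inter> ball p s)" "{j}"] by simp
    finally show "\<exists>s>0. of_nat j * emeasure \<mu> (ball p s) \<le> (\<integral>\<^sup>+ y\<in>ball p s. ennreal \<bar>f y\<bar> \<partial>\<mu>)"
      using \<open>s > 0\<close> by blast
  qed (use pos in blast)
  have "\<not> (AE x in \<mu>. max_c \<mu> f x \<noteq> \<infinity>)"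
  proof
    assume "AE x in \<mu>. max_c \<mu> f x \<noteq> \<infinity>"
    then have "AE x in \<mu>. x \<notin> ball 0 (1/16)" by eventually_elim (use inf in blast)
    then have "emeasure \<mu> (ball 0 (1/16)) = 0"
      by (subst (asm) AE_iff_measurable[of "ball 0 (1/16)"]) (auto simp: space)
    then show False using pos[of "1/16" 0] by simp
  qed
  then show ?thesis using \<open>f \<in> L1_loc \<mu>\<close> fin unfolding dichotomy_def by blast
qed

section \<open>From the limit superior to the growth condition and back\<close>

theorem theorem6p4p1:
  fixes \<mu> :: "'a::euclidean_space measure"
  assumes "sets \<mu> = sets borel"
    and "\<And>x r. r > 0 \<Longrightarrow> 0 < emeasure \<mu> (ball x r) \<and> emeasure \<mu> (ball x r) < \<infinity>"
  shows "dichotomy \<mu> \<longleftrightarrow>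
    (\<exists>y0. Limsup at_top (\<lambda>r::real. ereal (measure \<mu> (ball y0 (r + 1)) / measure \<mu> (ball y0 r))) < \<infinity>)"
proof
  have em: "emeasure \<mu> (ball x r) = ennreal (measure \<mu> (ball x r))" "0 < measure \<mu> (ball x r)" if "0 < r" for x r
  proof -
    show e: "emeasure \<mu> (ball x r) = ennreal (measure \<mu> (ball x r))"
      using assms(2)[OF that, of x] by (intro emeasure_eq_ennreal_measure) auto
    show "0 < measure \<mu> (ball x r)"
      using assms(2)[OF that, of x] unfolding e by simp
  qed
  {
    assume "\<exists>y0. Limsup at_top (\<lambda>r::real. ereal (measure \<mu> (ball y0 (r + 1)) / measure \<mu> (ball y0 r))) < \<infinity>"
    then obtain y0 C where "eventually (\<lambda>r. measure \<mu> (ball y0 (r + 1)) / measure \<mu> (ball y0 r) \<le> C) at_top"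
      using ratio_bounded_if_Limsup_finite by metis
    then obtain R where R: "\<And>r. R \<le> r \<Longrightarrow> measure \<mu> (ball y0 (r + 1)) / measure \<mu> (ball y0 r) \<le> C"
      by (auto simp: eventually_at_top_linorder)
    show "dichotomy \<mu>"
    proof (rule dichotomy_if_growth_bounded[OF assms])
      fix r assume "max 1 R \<le> r"
      then have r: "0 < r" "0 < r + 1" "R \<le> r" by auto
      have "measure \<mu> (ball y0 (r + 1)) \<le> C * measure \<mu> (ball y0 r)"
        using R[OF r(3)] em(2)[OF r(1), of y0] by (simp add: divide_le_eq)
      \<comment> \<open>\<open>ennreal\<close> truncates negative reals to 0, so the sign of
        \<open>C\<close> is needed to transfer the real inequality.\<close>
      moreover have "0 \<le> C"
        using R[OF r(3)] by (meson divide_nonneg_nonneg measure_nonneg order_trans)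
      ultimately show "emeasure \<mu> (ball y0 (r + 1)) \<le> ennreal C * emeasure \<mu> (ball y0 r)"
        using em(1)[OF r(1)] em(1)[OF r(2)] by (simp add: ennreal_mult[symmetric] ennreal_leI)
    qed
  next
    assume "dichotomy \<mu>"
    \<comment> \<open>Contraposition gives the growth bound at the origin, so the witness for
      \<open>y0\<close> is always 0.\<close>
    then obtain M R :: nat where
      *: "\<And>r. real R \<le> r \<Longrightarrow> \<not> of_nat M * emeasure \<mu> (ball 0 r) < emeasure \<mu> (ball 0 (r + 1))"
      using not_dichotomy_if_growth_unbounded[OF assms] by blast
    have "measure \<mu> (ball 0 (r + 1)) / measure \<mu> (ball 0 r) \<le> real M" if "real (Suc R) \<le> r" for r
    proof -
      have r: "0 < r" "0 < r + 1" "real R \<le> r" using that by auto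
      have "ennreal (measure \<mu> (ball 0 (r + 1))) \<le> ennreal (real M * measure \<mu> (ball 0 r))"
        using *[OF r(3)] em(1)[OF r(1)] em(1)[OF r(2)]
        by (simp add: ennreal_mult ennreal_of_nat_eq_real_of_nat not_less)
      then show ?thesis using em(2)[OF r(1), of 0] by (simp add: divide_le_eq)
    qed
    then have "eventually (\<lambda>r. ereal (measure \<mu> (ball 0 (r + 1)) / measure \<mu> (ball 0 r)) \<le> ereal (real M)) at_top"
      unfolding eventually_at_top_linorder by (intro exI[of _ "real (Suc R)"]) simp
    then have "Limsup at_top (\<lambda>r. ereal (measure \<mu> (ball 0 (r + 1)) / measure \<mu> (ball 0 r))) \<le> ereal (real M)"
      by (rule Limsup_bounded)
    then show "\<exists>y0. Limsup at_top (\<lambda>r::real. ereal (measure \<mu> (ball y0 (r + 1)) / measure \<mu> (ball y0 r))) < \<infinity>"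
      by (intro exI[of _ 0]) (auto intro: le_less_trans)
  }
qed

end
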